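(* Let $\mathcal H$ be an infinite-dimensional separable Hilbert space and let $T:\mathcal H\to\mathcal H$ be a hypercyclic operator with hypercyclic vector $\varphi$. Then for any frame $\{f_k\}_{k=1}^\infty$ for $\mathcal H$ and any $\epsilon>0$ there exist nonnegative integers $\alpha(k)$, $k\in\mathbb N$, such that $$\|f_k-T^{\alpha(k)}\varphi\|^2\le\frac{\epsilon}{2^k}\quad\text{for all }k\in\mathbb N.$$ Thus, for all sufficiently small $\epsilon>0$ (depending on the frame), $\{T^{\alpha(k)}\varphi\}_{k=1}^\infty$ is a frame for $\mathcal H$ with the same excess as $\{f_k\}_{k=1}^\infty$, and it is an $\epsilon$-approximation of $\{f_k\}_{k=1}^\infty$.
   Context: A bounded operator $T:\mathcal H\to\mathcal H$ is hypercyclic if there is a vector $\varphi\in\mathcal H$ (called a hypercyclic vector) such that the orbit $\{T^n\varphi\}_{n=0}^\infty$ is dense in $\mathcal H$. A sequence $\{f_k\}_{k=1}^\infty$ in $\mathcal H$ is a frame if there are $A,B>0$ with $A\|f\|^2\le\sum_k|\langle f,f_k\rangle|^2\le B\|f\|^2$ for all $f\in\mathcal H$. The excess of a frame is the supremum (in $\mathbb N_0\cup\{\infty\}$) of the numbers $n$ such that some $n$ elements can be removed leaving a frame; equivalently, it is the dimension of the kernel of the synthesis operator $\{c_k\}\mapsto\sum_kc_kf_k$ on $\ell^2(\mathbb N)$ (finite or $\infty$). A sequence $\{\widetilde f_k\}_{k=1}^\infty\subset\mathcal H$ is an $\epsilon$-approximation of $\{f_k\}_{k=1}^\infty$ if $\left\|\sum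 c_k(f_k-\widetilde f_k)\right\|^2\le\epsilon\sum|c_k|^2$ for all finite scalar sequences $\{c_k\}$. *)

theory Defs
  imports "HOL-Analysis.Analysis" "HOL-Library.Extended_Nat"
begin

text \<open>
  Scalars are real or complex numbers.  The class axioms say that the norm is induced by an
  involutive field automorphism; up to isomorphism the only instances are the real numbers (with
  trivial conjugation) and the complex numbers (with the usual one): every element \<open>x\<close> is a root
  of the real polynomial \<open>(X - x) (X - conj x)\<close>.
\<close>

class hilbert_scalar = real_normed_field +
  fixes conj :: "'a \<Rightarrow> 'a"
  assumes conj_add: "conj (x + y) = conj x + conj y"
    and conj_mult: "conj (x * y) = conj x * conj y"
    and conj_conj: "conj (conj x) = x"
    and mult_conj: "x * conj x = ((norm x)\<^sup>2) *\<^sub>R 1"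

instantiation real :: hilbert_scalar
begin
definition conj_real :: "real \<Rightarrow> real" where "conj_real x = x"
instance by standard (auto simp: conj_real_def power2_eq_square)
end

instantiation complex :: hilbert_scalar
begin
definition conj_complex :: "complex \<Rightarrow> complex" where "conj_complex x = cnj x"
instance by standard (auto simp: conj_complex_def complex_norm_square scaleR_conv_of_real simp del: of_real_power)
end

text \<open>
  Norm, topology and completeness come from the class \<open>banach\<close>; the locale adds scalar
  multiplication by \<open>'k\<close> and an inner product (linear in the first argument) inducing that norm.
\<close>

locale hilbert_space = vector_space smul
  for smul :: "'k::hilbert_scalar \<Rightarrow> 'a::banach \<Rightarrow> 'a" +
  fixes ip :: "'a \<Rightarrow> 'a \<Rightarrow> 'k"
  assumes smul_of_real: "smul (of_real r) x = r *\<^sub>R x"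
    and ip_add_left: "ip (x + y) z = ip x z + ip y z"
    and ip_smul_left: "ip (smul c x) y = c * ip x y"
    and ip_conj: "ip y x = conj (ip x y)"
    and ip_self: "ip x x = of_real ((norm x)\<^sup>2)"

lemma hilbert_space_real:
  "hilbert_space (scaleR :: real \<Rightarrow> 'a::{real_inner, banach} \<Rightarrow> 'a) inner"
  by unfold_locales
    (auto simp: inner_add_left inner_commute conj_real_def power2_norm_eq_inner algebra_simps)

lemma hilbert_space_complex:
  "hilbert_space ((*) :: complex \<Rightarrow> complex \<Rightarrow> complex) (\<lambda>x y. x * cnj y)"
  by unfold_locales
    (auto simp: conj_complex_def complex_norm_square scaleR_conv_of_real algebra_simps
      simp del: of_real_power)

definition infinite_dimensional :: "('k::field \<Rightarrow> 'a::ab_group_add \<Rightarrow> 'a) \<Rightarrow> bool" where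
  "infinite_dimensional smul \<longleftrightarrow> \<not> (\<exists>B. finite B \<and> module.span smul B = UNIV)"

definition bounded_operator :: "('k::field \<Rightarrow> 'a::real_normed_vector \<Rightarrow> 'a) \<Rightarrow> ('a \<Rightarrow> 'a) \<Rightarrow> bool" where
  "bounded_operator smul T \<longleftrightarrow>
     Vector_Spaces.linear smul smul T \<and> (\<exists>K. \<forall>x. norm (T x) \<le> K * norm x)"

definition hypercyclic_vector :: "('a::topological_space \<Rightarrow> 'a) \<Rightarrow> 'a \<Rightarrow> bool" where
  "hypercyclic_vector T \<phi> \<longleftrightarrow> closure (range (\<lambda>n. (T ^^ n) \<phi>)) = UNIV"

text \<open>
  Families carry an explicit index set \<open>I\<close>, so that removing elements is removing indices.
  Summability is required explicitly because \<open>infsum\<close> is 0 on non-summable families.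
\<close>

definition is_frame ::
  "('a::real_normed_vector \<Rightarrow> 'a \<Rightarrow> 'k::real_normed_field) \<Rightarrow> 'i set \<Rightarrow> ('i \<Rightarrow> 'a) \<Rightarrow> bool" where
  "is_frame ip I f \<longleftrightarrow>
     (\<exists>A B. A > 0 \<and> B > 0 \<and>
       (\<forall>x. (\<lambda>k. (norm (ip x (f k)))\<^sup>2) summable_on I \<and>
            A * (norm x)\<^sup>2 \<le> (\<Sum>\<^sub>\<infinity>k\<in>I. (norm (ip x (f k)))\<^sup>2) \<and>
            (\<Sum>\<^sub>\<infinity>k\<in>I. (norm (ip x (f k)))\<^sup>2) \<le> B * (norm x)\<^sup>2))"

definition excess ::
  "('a::real_normed_vector \<Rightarrow> 'a \<Rightarrow> 'k::real_normed_field) \<Rightarrow> 'i set \<Rightarrow> ('i \<Rightarrow> 'a) \<Rightarrow> enat" where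
  "excess ip I f = Sup {enat (card J) | J. finite J \<and> J \<subseteq> I \<and> is_frame ip (I - J) f}"

definition eps_approximation ::
  "('k::real_normed_field \<Rightarrow> 'a::real_normed_vector \<Rightarrow> 'a) \<Rightarrow> real \<Rightarrow> 'i set \<Rightarrow>
    ('i \<Rightarrow> 'a) \<Rightarrow> ('i \<Rightarrow> 'a) \<Rightarrow> bool" where
  "eps_approximation smul \<epsilon> I g f \<longleftrightarrow>
     (\<forall>F c. finite F \<and> F \<subseteq> I \<longrightarrow>
       (norm (\<Sum>k\<in>F. smul (c k) (f k - g k)))\<^sup>2 \<le> \<epsilon> * (\<Sum>k\<in>F. (norm (c k))\<^sup>2))"

end

theory Submission imports Defs begin

text \<open>
  Let \<open>a\<close> be a lower frame bound of \<open>f\<close>, in the sense that \<open>a\<close> times the norm of \<open>x\<close> is at most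
  the \<open>\<ell>\<^sup>2\<close> norm of its coefficients.  If \<open>g\<close> is at \<open>\<ell>\<^sup>2\<close> distance \<open>d < a\<close> from \<open>f\<close>, every point
  \<open>h\<^sub>t = f + t (g - f)\<close> of the segment is a frame, and the excess is constant along it: for every \<open>n\<close>,
  the set of those \<open>t \<in> [0, 1]\<close> with excess at least \<open>n\<close> is open and closed.  It is open because
  removing finitely many elements leaves a frame whose lower bound survives small perturbations.
  Its complement is open: if the excess is less than \<open>n\<close>, removing a largest removable set \<open>J\<close> leaves
  a frame from which nothing can be removed, hence a Riesz basis; that too survives small
  perturbations, and over a Riesz basis with \<open>|J|\<close> extra elements no set larger than \<open>J\<close> is
  removable.  Working with almost biorthogonal vectors and approximations by finite sums, this
  needs neither limits of series nor the frame operator.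
\<close>

section \<open>Linear systems, finite l2 norms and extended naturals\<close>

text \<open>Gaussian elimination: a pivot \<open>p\<close> for equation \<open>j\<close> removes one
  unknown and one equation, and the value at \<open>p\<close> is recovered by back substitution.
  Without a pivot, equation \<open>j\<close> holds trivially.\<close>

lemma nontrivial_solution:
  fixes c :: "'i \<Rightarrow> 'j \<Rightarrow> 'k::field"
  assumes "finite G" "finite F" "card G < card F"
  shows "\<exists>l. (\<exists>k\<in>F. l k \<noteq> 0) \<and> (\<forall>j\<in>G. (\<Sum>k\<in>F. l k * c k j) = 0)"
  using assms
proof (induction G arbitrary: F c rule: finite_induct)
  case empty
  then obtain k where "k \<in> F" by fastforce
  then show ?case by (intro exI[of _ "\<lambda>_. 1"]) auto
next
  case (insert j G)
  show ?case
  proof (cases "\<exists>p\<in>F. c p j \<noteq> 0")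
    case False
    with insert.IH[of F c] insert.prems insert.hyps show ?thesis by auto
  next
    case True
    then obtain p where p: "p \<in> F" "c p j \<noteq> 0" by blast
    define c' where "c' = (\<lambda>k i. c k i - c k j / c p j * c p i)"
    have "card G < card (F - {p})" using insert p by simp
    then obtain l where l: "\<exists>k\<in>F - {p}. l k \<noteq> 0"
      and l0: "\<And>i. i \<in> G \<Longrightarrow> (\<Sum>k\<in>F - {p}. l k * c' k i) = 0"
      using insert.IH[of "F - {p}" c'] insert.prems by blast
    define l' where "l' = l(p := - (\<Sum>k\<in>F - {p}. l k * c k j) / c p j)"
    have s: "(\<Sum>k\<in>F. l' k * c k i) =
        (\<Sum>k\<in>F - {p}. l k * c k i) - (\<Sum>k\<in>F - {p}. l k * c k j) / c p j * c p i" for i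
    proof -
      have "(\<Sum>k\<in>F - {p}. l' k * c k i) = (\<Sum>k\<in>F - {p}. l k * c k i)"
        by (rule sum.cong) (auto simp: l'_def)
      then show ?thesis
        using insert.prems p by (simp add: sum.remove[of F p] l'_def)
    qed
    have "(\<Sum>k\<in>F. l' k * c k i) = 0" if "i \<in> G" for i
    proof -
      have "(\<Sum>k\<in>F - {p}. l k * c' k i) = (\<Sum>k\<in>F. l' k * c k i)"
        unfolding s c'_def
        by (simp add: algebra_simps sum_subtractf sum_divide_distrib sum_distrib_left)
      then show ?thesis using l0[OF that] by simp
    qed
    moreover have "(\<Sum>k\<in>F. l' k * c k j) = 0" using s[of j] p by simp
    moreover have "\<exists>k\<in>F. l' k \<noteq> 0" using l by (auto simp: l'_def)
    ultimately show ?thesis by blast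
  qed
qed

lemma L2_set_subset:
  assumes "finite G" "F \<subseteq> G"
  shows "L2_set f F \<le> L2_set f G"
  unfolding L2_set_def using assms by (intro real_sqrt_le_mono sum_mono2) auto

lemma L2_set_sum_le: "L2_set (\<lambda>j. \<Sum>k\<in>F. u k j) G \<le> (\<Sum>k\<in>F. L2_set (u k) G)"
proof (induction F rule: infinite_finite_induct)
  case (insert k F)
  then show ?case
    using L2_set_triangle_ineq[of "u k" "\<lambda>j. \<Sum>k\<in>F. u k j" G] by simp
qed (simp_all add: L2_set_def)

text \<open>The successor of a finite value separates it from infinity. This reduces equality of
  excesses, which may be infinite, to one equivalence for each finite \<open>n\<close>.\<close>

lemma enat_eqI:
  assumes "\<And>n. enat n \<le> x \<longleftrightarrow> enat n \<le> y"
  shows "x = y"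
proof -
  have "u \<le> v" if "\<And>n. enat n \<le> u \<Longrightarrow> enat n \<le> v" for u v
  proof (cases u)
    case infinity
    then show ?thesis using that[of "Suc (the_enat v)"] by (cases v) auto
  qed (use that in simp)
  then show ?thesis using assms by (intro antisym) auto
qed

section \<open>Conjugation and the inner product\<close>

lemma norm_conj [simp]: "norm (conj x) = norm (x :: 'k::hilbert_scalar)"
proof (cases "x = 0")
  case True
  then show ?thesis using conj_add[of 0 "0::'k"] by simp
next
  case False
  have "norm x * norm (conj x) = (norm x)\<^sup>2"
    using mult_conj[of x] by (simp flip: norm_mult)
  then show ?thesis using False by (simp add: power2_eq_square)
qed

lemma conj_zero [simp]: "conj 0 = (0 :: 'k::hilbert_scalar)"
  using norm_conj[of "0::'k"] by (simp del: norm_conj)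

lemma conj_diff: "conj (x - y) = conj x - conj (y :: 'k::hilbert_scalar)"
  using conj_add[of "x - y" y] by simp

text \<open>The class axioms do not state that conjugation fixes the reals; it follows by cancelling
  \<open>r\<close> in \<open>mult_conj\<close>.\<close>

lemma conj_of_real [simp]: "conj (of_real r) = (of_real r :: 'k::hilbert_scalar)"
proof (cases "r = 0")
  case False
  then show ?thesis using mult_conj[of "of_real r :: 'k"]
    by (simp add: power2_eq_square scaleR_conv_of_real)
qed simp

lemma mult_conj': "x * conj x = (of_real ((norm x)\<^sup>2) :: 'k::hilbert_scalar)"
  by (simp only: mult_conj of_real_def)

context hilbert_space
begin

lemma ip_zero_left [simp]: "ip 0 y = 0"
  using ip_add_left[of 0 0 y] by simp

lemma ip_add_right: "ip x (y + z) = ip x y + ip x z"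
  by (metis conj_add ip_add_left ip_conj)

lemma ip_smul_right: "ip x (smul c y) = conj c * ip x y"
  by (metis conj_mult ip_conj ip_smul_left)

lemma ip_zero_right [simp]: "ip y 0 = 0"
  using ip_add_right[of y 0 0] by simp

lemma ip_diff_left: "ip (x - y) z = ip x z - ip y z"
  using ip_add_left[of "x - y" y z] by simp

lemma ip_diff_right: "ip x (y - z) = ip x y - ip x z"
  using ip_add_right[of x "y - z" z] by simp

lemma ip_sum_left: "ip (sum g F) y = (\<Sum>k\<in>F. ip (g k) y)"
  by (induction F rule: infinite_finite_induct) (auto simp: ip_add_left)

lemma ip_sum_right: "ip y (sum g F) = (\<Sum>k\<in>F. ip y (g k))"
  by (induction F rule: infinite_finite_induct) (auto simp: ip_add_right)

lemma norm_ip_commute: "norm (ip x y) = norm (ip y x)"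
  by (metis ip_conj norm_conj)

lemma norm_smul [simp]: "norm (smul c x) = norm c * norm x"
proof -
  have "of_real ((norm (smul c x))\<^sup>2) = c * conj c * of_real ((norm x)\<^sup>2)"
    by (simp only: ip_self[symmetric] ip_smul_left ip_smul_right mult_ac)
  then have "of_real ((norm (smul c x))\<^sup>2) = (of_real ((norm c * norm x)\<^sup>2) :: 'k)"
    by (simp add: mult_conj' power_mult_distrib)
  then have "(norm (smul c x))\<^sup>2 = (norm c * norm x)\<^sup>2"
    by (simp only: of_real_eq_iff)
  then show ?thesis by simp
qed

lemma cauchy_schwarz: "norm (ip x y) \<le> norm x * norm y"
proof (cases "y = 0")
  case False
  define N where "N = (norm y)\<^sup>2"
  define a where "a = ip x y"
  \<comment> \<open>The coefficient of the orthogonal projection of \<open>x\<close> onto the line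
    of \<open>y\<close>; the claim is that the squared distance to this projection is
    nonnegative.\<close>
  define c where "c = a / of_real N"
  have N: "N > 0" using False by (simp add: N_def)
  have cc: "conj c = conj a / of_real N"
  proof -
    have "conj c * of_real N = conj a"
      using conj_mult[of c "of_real N"] N by (simp add: c_def)
    then show ?thesis using N by (simp add: field_simps)
  qed
  have "of_real ((norm (x - smul c y))\<^sup>2) =
      ip x x - conj c * a - c * conj a + c * conj c * of_real N"
    by (simp add: ip_self[symmetric] ip_diff_left ip_diff_right ip_smul_left ip_smul_right
        a_def N_def ip_conj[of y x] algebra_simps del: of_real_power)
  also have "\<dots> = ip x x - a * conj a / of_real N"
    unfolding cc c_def using N by (simp add: field_simps)
  also have "\<dots> = of_real ((norm x)\<^sup>2 - (norm a)\<^sup>2 / N)"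
    by (simp add: ip_self mult_conj')
  finally have "(norm (x - smul c y))\<^sup>2 = (norm x)\<^sup>2 - (norm a)\<^sup>2 / N"
    by (simp only: of_real_eq_iff)
  then have "0 \<le> (norm x)\<^sup>2 - (norm a)\<^sup>2 / N"
    by (metis zero_le_power2)
  then have "(norm a)\<^sup>2 \<le> (norm x * norm y)\<^sup>2"
    using N by (simp add: N_def field_simps)
  then show ?thesis unfolding a_def by (rule power2_le_imp_le) simp
qed simp

section \<open>Frame and Riesz bounds tested on finite sets\<close>

text \<open>Bounds here and below refer to norms instead of squares, so \<open>b\<close> is the
  square root of a usual Bessel bound. Testing on finite sets keeps infinite sums out of the later
  estimates.\<close>

definition bessel :: "real \<Rightarrow> 'i set \<Rightarrow> ('i \<Rightarrow> 'a) \<Rightarrow> bool" where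
  "bessel b I f \<longleftrightarrow>
     (\<forall>x F. finite F \<longrightarrow> F \<subseteq> I \<longrightarrow> L2_set (\<lambda>k. norm (ip x (f k))) F \<le> b * norm x)"

text \<open>Asking a finite set to attain the bound is slightly stronger than bounding the full sum
  with the same constant.\<close>

definition lower_bound :: "real \<Rightarrow> 'i set \<Rightarrow> ('i \<Rightarrow> 'a) \<Rightarrow> bool" where
  "lower_bound a I f \<longleftrightarrow>
     (\<forall>x. \<exists>F. finite F \<and> F \<subseteq> I \<and> a * norm x \<le> L2_set (\<lambda>k. norm (ip x (f k))) F)"

definition riesz :: "real \<Rightarrow> 'i set \<Rightarrow> ('i \<Rightarrow> 'a) \<Rightarrow> bool" where
  "riesz r I f \<longleftrightarrow>
     (\<forall>c F. finite F \<longrightarrow> F \<subseteq> I \<longrightarrow>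
       r * L2_set (\<lambda>k. norm (c k)) F \<le> norm (\<Sum>k\<in>F. smul (c k) (f k)))"

definition close :: "real \<Rightarrow> 'i set \<Rightarrow> ('i \<Rightarrow> 'a) \<Rightarrow> ('i \<Rightarrow> 'a) \<Rightarrow> bool" where
  "close d I f g \<longleftrightarrow> (\<forall>F. finite F \<longrightarrow> F \<subseteq> I \<longrightarrow> L2_set (\<lambda>k. norm (f k - g k)) F \<le> d)"

lemma close_subset: "close d I f g \<Longrightarrow> J \<subseteq> I \<Longrightarrow> close d J f g"
  unfolding close_def by blast

text \<open>Bounds on finite partial sums pass to the infinite sum and back. Only the lower bound
  loses something: with \<open>A/2\<close> in place of \<open>A\<close> it is strict for nonzero
  \<open>x\<close>, so a finite partial sum already exceeds it.\<close>

lemma is_frame_iff: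
  "is_frame ip I f \<longleftrightarrow> (\<exists>a>0. lower_bound a I f) \<and> (\<exists>b>0. bessel b I f)"
proof (intro iffI conjI; (elim conjE)?)
  assume "is_frame ip I f"
  then obtain A B where AB: "A > 0" "B > 0"
    and sm: "\<And>x. (\<lambda>k. (norm (ip x (f k)))\<^sup>2) summable_on I"
    and lo: "\<And>x. A * (norm x)\<^sup>2 \<le> (\<Sum>\<^sub>\<infinity>k\<in>I. (norm (ip x (f k)))\<^sup>2)"
    and up: "\<And>x. (\<Sum>\<^sub>\<infinity>k\<in>I. (norm (ip x (f k)))\<^sup>2) \<le> B * (norm x)\<^sup>2"
    unfolding is_frame_def by blast
  have "L2_set (\<lambda>k. norm (ip x (f k))) F \<le> sqrt B * norm x" if "finite F" "F \<subseteq> I" for x F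
  proof -
    have "(\<Sum>k\<in>F. (norm (ip x (f k)))\<^sup>2) \<le> B * (norm x)\<^sup>2"
      by (rule order_trans[OF finite_sum_le_infsum[OF sm that] up[of x]]) simp
    then show ?thesis unfolding L2_set_def
      by (metis norm_ge_zero real_sqrt_le_mono real_sqrt_mult real_sqrt_pow2 real_sqrt_unique)
  qed
  then show "\<exists>b>0. bessel b I f" unfolding bessel_def
    using AB by (intro exI[of _ "sqrt B"]) auto
  have "\<exists>F. finite F \<and> F \<subseteq> I \<and> sqrt (A/2) * norm x \<le> L2_set (\<lambda>k. norm (ip x (f k))) F" for x
  proof (cases "x = 0")
    case True
    then show ?thesis by (intro exI[of _ "{}"]) auto
  next
    case False
    then have "A/2 * (norm x)\<^sup>2 < (\<Sum>\<^sub>\<infinity>k\<in>I. (norm (ip x (f k)))\<^sup>2)"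
      using lo[of x] AB by (smt (verit) field_sum_of_halves mult_strict_right_mono zero_less_norm_iff zero_less_power)
    then obtain F where F: "finite F" "F \<subseteq> I" "A/2 * (norm x)\<^sup>2 < (\<Sum>k\<in>F. (norm (ip x (f k)))\<^sup>2)"
      using infsum_le_finite_sums[OF sm[of x], of "A/2 * (norm x)\<^sup>2"] by (meson not_le)
    have "sqrt (A/2) * norm x = sqrt (A/2 * (norm x)\<^sup>2)"
      by (simp only: real_sqrt_mult real_sqrt_abs abs_norm_cancel)
    also have "\<dots> \<le> L2_set (\<lambda>k. norm (ip x (f k))) F" unfolding L2_set_def
      using F by (intro real_sqrt_le_mono) simp
    finally show ?thesis using F by blast
  qed
  then show "\<exists>a>0. lower_bound a I f" unfolding lower_bound_def
    using AB by (intro exI[of _ "sqrt (A/2)"]) auto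
next
  assume "\<exists>a>0. lower_bound a I f" "\<exists>b>0. bessel b I f"
  then obtain a b where ab: "a > 0" "b > 0" "lower_bound a I f" "bessel b I f" by blast
  have up: "(\<Sum>k\<in>F. (norm (ip x (f k)))\<^sup>2) \<le> b\<^sup>2 * (norm x)\<^sup>2" if "finite F" "F \<subseteq> I" for x F
  proof -
    have "L2_set (\<lambda>k. norm (ip x (f k))) F \<le> b * norm x"
      using ab that unfolding bessel_def by blast
    from power_mono[OF this, of 2] show ?thesis
      by (simp add: L2_set_def sum_nonneg power_mult_distrib)
  qed
  have sm: "(\<lambda>k. (norm (ip x (f k)))\<^sup>2) summable_on I" for x
    by (rule nonneg_bdd_above_summable_on) (auto intro!: bdd_aboveI2 up)
  have lo: "a\<^sup>2 * (norm x)\<^sup>2 \<le> (\<Sum>\<^sub>\<infinity>k\<in>I. (norm (ip x (f k)))\<^sup>2)" for x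
  proof -
    obtain F where F: "finite F" "F \<subseteq> I" "a * norm x \<le> L2_set (\<lambda>k. norm (ip x (f k))) F"
      using ab unfolding lower_bound_def by blast
    from power_mono[OF this(3), of 2] have "a\<^sup>2 * (norm x)\<^sup>2 \<le> (\<Sum>k\<in>F. (norm (ip x (f k)))\<^sup>2)"
      using ab by (simp add: L2_set_def sum_nonneg power_mult_distrib)
    then show ?thesis
      by (rule order_trans[OF _ finite_sum_le_infsum[OF sm F(1,2)]]) simp
  qed
  show "is_frame ip I f" unfolding is_frame_def
    using ab sm lo infsum_le_finite_sums[OF sm up]
    by (intro exI[of _ "a\<^sup>2"] exI[of _ "b\<^sup>2"]) auto
qed

section \<open>Stability of the bounds under l2 perturbation\<close>

lemma close_ip:
  assumes "close d I f g" "finite F" "F \<subseteq> I"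
  shows "L2_set (\<lambda>k. norm (ip x (f k - g k))) F \<le> d * norm x"
proof -
  have "L2_set (\<lambda>k. norm (ip x (f k - g k))) F \<le> L2_set (\<lambda>k. norm x * norm (f k - g k)) F"
    by (rule L2_set_mono) (auto simp: cauchy_schwarz)
  also have "\<dots> = norm x * L2_set (\<lambda>k. norm (f k - g k)) F"
    by (simp add: L2_set_right_distrib)
  also have "\<dots> \<le> norm x * d"
    using assms unfolding close_def by (intro mult_left_mono) auto
  finally show ?thesis by (simp add: mult.commute)
qed

text \<open>Cauchy-Schwarz for the sum over \<open>F\<close>. The bound on the synthesis of the
  difference serves both the Riesz bounds and the \<epsilon>-approximation.\<close>

lemma close_synthesis:
  assumes "close d I f g" "finite F" "F \<subseteq> I"
  shows "norm (\<Sum>k\<in>F. smul (c k) (f k - g k)) \<le> d * L2_set (\<lambda>k. norm (c k)) F"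
proof -
  have "norm (\<Sum>k\<in>F. smul (c k) (f k - g k)) \<le> (\<Sum>k\<in>F. \<bar>norm (c k)\<bar> * \<bar>norm (f k - g k)\<bar>)"
    by (rule order_trans[OF norm_sum]) simp
  also have "\<dots> \<le> L2_set (\<lambda>k. norm (c k)) F * L2_set (\<lambda>k. norm (f k - g k)) F"
    by (rule L2_set_mult_ineq)
  also have "\<dots> \<le> L2_set (\<lambda>k. norm (c k)) F * d"
    using assms unfolding close_def by (intro mult_left_mono) auto
  finally show ?thesis by (simp add: mult.commute)
qed

lemma close_sym: "close d I f g \<Longrightarrow> close d I g f"
  unfolding close_def by (simp add: norm_minus_commute)

lemma L2_ip_triangle:
  "L2_set (\<lambda>k. norm (ip x (f k))) F \<le>
     L2_set (\<lambda>k. norm (ip x (g k))) F + L2_set (\<lambda>k. norm (ip x (f k - g k))) F"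
proof -
  have "L2_set (\<lambda>k. norm (ip x (f k))) F \<le>
      L2_set (\<lambda>k. norm (ip x (g k)) + norm (ip x (f k - g k))) F"
    by (rule L2_set_mono) (auto simp: ip_diff_right norm_triangle_sub)
  also have "\<dots> \<le> L2_set (\<lambda>k. norm (ip x (g k))) F + L2_set (\<lambda>k. norm (ip x (f k - g k))) F"
    by (rule L2_set_triangle_ineq)
  finally show ?thesis .
qed

lemma lower_bound_perturb:
  assumes "lower_bound a I f" "close d I f g"
  shows "lower_bound (a - d) I g"
  unfolding lower_bound_def
proof
  fix x
  obtain F where F: "finite F" "F \<subseteq> I" "a * norm x \<le> L2_set (\<lambda>k. norm (ip x (f k))) F"
    using assms unfolding lower_bound_def by blast
  have "(a - d) * norm x \<le> L2_set (\<lambda>k. norm (ip x (g k))) F"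
    using F(3) L2_ip_triangle[of x f F g] close_ip[OF assms(2) F(1,2), of x]
    by (simp add: algebra_simps)
  then show "\<exists>F. finite F \<and> F \<subseteq> I \<and> (a - d) * norm x \<le> L2_set (\<lambda>k. norm (ip x (g k))) F"
    using F by blast
qed

lemma bessel_perturb:
  assumes "bessel b I f" "close d I f g"
  shows "bessel (b + d) I g"
  unfolding bessel_def
proof (intro allI impI)
  fix x F assume F: "finite F" "F \<subseteq> I"
  have "L2_set (\<lambda>k. norm (ip x (f k))) F \<le> b * norm x"
    using assms F unfolding bessel_def by blast
  then show "L2_set (\<lambda>k. norm (ip x (g k))) F \<le> (b + d) * norm x"
    using L2_ip_triangle[of x g F f] close_ip[OF close_sym[OF assms(2)] F, of x]
    by (simp add: algebra_simps)
qed

lemma close_nonneg: "close d I f g \<Longrightarrow> 0 \<le> d"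
  unfolding close_def by (metis L2_set_empty empty_subsetI finite.emptyI)

text \<open>\<open>is_frame\<close> hides its constants, so the lower bound to be compared with
  \<open>d\<close> is passed separately; \<open>a - d\<close> and \<open>b + d\<close> are then
  positive bounds for \<open>g\<close>.\<close>

lemma is_frame_perturb:
  assumes "is_frame ip I f" "lower_bound a I f" "close d I f g" "d < a"
  shows "is_frame ip I g"
  using assms lower_bound_perturb[OF assms(2,3)] bessel_perturb[OF _ assms(3)] close_nonneg[OF assms(3)]
  unfolding is_frame_iff by (metis add_pos_nonneg diff_gt_0_iff_gt)

lemma riesz_perturb:
  assumes "riesz r I f" "close d I f g"
  shows "riesz (r - d) I g"
  unfolding riesz_def
proof (intro allI impI)
  fix c :: "'b \<Rightarrow> 'k" and F :: "'b set" assume F: "finite F" "F \<subseteq> I"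
  have "r * L2_set (\<lambda>k. norm (c k)) F \<le> norm (\<Sum>k\<in>F. smul (c k) (f k))"
    using assms F unfolding riesz_def by blast
  moreover have "(\<Sum>k\<in>F. smul (c k) (f k)) =
      (\<Sum>k\<in>F. smul (c k) (g k)) + (\<Sum>k\<in>F. smul (c k) (f k - g k))"
    by (simp add: scale_right_diff_distrib sum_subtractf)
  ultimately show "(r - d) * L2_set (\<lambda>k. norm (c k)) F \<le> norm (\<Sum>k\<in>F. smul (c k) (g k))"
    using close_synthesis[OF assms(2) F, of c]
      norm_triangle_ineq[of "\<Sum>k\<in>F. smul (c k) (g k)" "\<Sum>k\<in>F. smul (c k) (f k - g k)"]
    by (simp add: algebra_simps)
qed

section \<open>Synthesis and density of the span\<close>

text \<open>Synthesis is adjoint to analysis: expanding only the first argument of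
  \<open>ip u u\<close> leaves the coefficients of \<open>u\<close> itself, which the Bessel bound
  controls, and one factor \<open>norm u\<close> cancels.\<close>

lemma bessel_synthesis:
  assumes "bessel b I f" "b > 0" "finite F" "F \<subseteq> I"
  shows "norm (\<Sum>k\<in>F. smul (c k) (f k)) \<le> b * L2_set (\<lambda>k. norm (c k)) F"
proof -
  define u where "u = (\<Sum>k\<in>F. smul (c k) (f k))"
  have "(norm u)\<^sup>2 = norm (ip u u)" by (simp add: ip_self flip: of_real_power)
  also have "ip u u = (\<Sum>k\<in>F. c k * ip (f k) u)"
    by (subst u_def) (simp add: ip_sum_left ip_smul_left)
  also have "norm \<dots> \<le> (\<Sum>k\<in>F. \<bar>norm (c k)\<bar> * \<bar>norm (ip u (f k))\<bar>)"
    by (rule order_trans[OF norm_sum]) (simp add: norm_mult norm_ip_commute[of u])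
  also have "\<dots> \<le> L2_set (\<lambda>k. norm (c k)) F * L2_set (\<lambda>k. norm (ip u (f k))) F"
    by (rule L2_set_mult_ineq)
  also have "\<dots> \<le> L2_set (\<lambda>k. norm (c k)) F * (b * norm u)"
    using assms unfolding bessel_def by (intro mult_left_mono) auto
  finally have "norm u * norm u \<le> (b * L2_set (\<lambda>k. norm (c k)) F) * norm u"
    by (simp add: power2_eq_square mult_ac)
  then show ?thesis
    using assms(2) by (cases "u = 0") (auto simp: u_def)
qed

text \<open>
  One step of the frame algorithm; iterating it gives the density of the span without
  orthogonal complements.
\<close>

lemma frame_step:
  assumes "lower_bound a I f" "a > 0" "bessel b I f" "b > 0"
  shows "\<exists>u\<in>span (f ` I). (norm (x - u))\<^sup>2 \<le> (1 - a\<^sup>2 / b\<^sup>2) * (norm x)\<^sup>2"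
proof -
  obtain F where F: "finite F" "F \<subseteq> I" "a * norm x \<le> L2_set (\<lambda>k. norm (ip x (f k))) F"
    using assms unfolding lower_bound_def by blast
  define s where "s = (\<Sum>k\<in>F. (norm (ip x (f k)))\<^sup>2)"
  \<comment> \<open>The frame operator at \<open>x\<close>, truncated to \<open>F\<close>; this
    makes \<open>ip x u\<close> the real number \<open>s\<close>.\<close>
  define u where "u = (\<Sum>k\<in>F. smul (ip x (f k)) (f k))"
  \<comment> \<open>The step length that minimises the bound
    \<open>- 2 * t * s + t\<^sup>2 * (b\<^sup>2 * s)\<close>.\<close>
  define t where "t = 1 / b\<^sup>2"
  have s: "L2_set (\<lambda>k. norm (ip x (f k))) F = sqrt s" "s \<ge> 0"
    by (auto simp: L2_set_def s_def sum_nonneg)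
  have sa: "a\<^sup>2 * (norm x)\<^sup>2 \<le> s"
    using power_mono[OF F(3), of 2] assms s by (simp add: power_mult_distrib)
  have "norm u \<le> b * sqrt s"
    using bessel_synthesis[OF assms(3,4) F(1,2), of "\<lambda>k. ip x (f k)"] s by (simp add: u_def)
  from power_mono[OF this, of 2] have ub: "(norm u)\<^sup>2 \<le> b\<^sup>2 * s"
    using s by (simp add: power_mult_distrib)
  have xu: "ip x u = of_real s"
    by (simp add: u_def s_def ip_sum_right ip_smul_right mult_conj' mult.commute[of "conj _"] del: of_real_power)
  then have ux: "ip u x = of_real s" using ip_conj[of u x] by simp
  have "of_real ((norm (x - smul (of_real t) u))\<^sup>2) =
      ip x x - 2 * of_real t * of_real s + (of_real t)\<^sup>2 * ip u u"
    unfolding ip_self[symmetric]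
    by (simp add: ip_diff_left ip_diff_right ip_smul_left ip_smul_right xu ux
        power2_eq_square algebra_simps)
  also have "\<dots> = of_real ((norm x)\<^sup>2 - 2 * t * s + t\<^sup>2 * (norm u)\<^sup>2)"
    by (simp add: ip_self)
  finally have "(norm (x - smul (of_real t) u))\<^sup>2 = (norm x)\<^sup>2 - 2 * t * s + t\<^sup>2 * (norm u)\<^sup>2"
    by (simp only: of_real_eq_iff)
  also have "\<dots> \<le> (norm x)\<^sup>2 - 2 * t * s + t\<^sup>2 * (b\<^sup>2 * s)"
    using ub by (intro add_left_mono mult_left_mono) auto
  also have "t\<^sup>2 * (b\<^sup>2 * s) = t * s"
    using assms by (simp add: t_def power2_eq_square)
  also have "(norm x)\<^sup>2 - 2 * t * s + t * s \<le> (norm x)\<^sup>2 - t * (a\<^sup>2 * (norm x)\<^sup>2)"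
    using mult_left_mono[OF sa, of t] by (simp add: t_def)
  also have "\<dots> = (1 - a\<^sup>2 / b\<^sup>2) * (norm x)\<^sup>2"
    by (simp add: t_def algebra_simps)
  finally have "(norm (x - smul (of_real t) u))\<^sup>2 \<le> (1 - a\<^sup>2 / b\<^sup>2) * (norm x)\<^sup>2" .
  moreover have "smul (of_real t) u \<in> span (f ` I)"
    unfolding u_def using F by (intro span_scale span_sum) (auto intro: span_base)
  ultimately show ?thesis by blast
qed

lemma frame_dense_span:
  assumes "is_frame ip I f" "\<delta> > 0"
  shows "\<exists>z\<in>span (f ` I). norm (y - z) < \<delta>"
proof -
  obtain a b where ab: "lower_bound a I f" "a > 0" "bessel b I f" "b > 0"
    using assms unfolding is_frame_iff by blast
  \<comment> \<open>The maximum with 0 makes \<open>q\<close> nonnegative without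
    \<open>a \<le> b\<close>, which can fail in the zero space.\<close>
  define q where "q = max 0 (1 - a\<^sup>2 / b\<^sup>2)"
  have q: "0 \<le> q" "q < 1" using ab by (auto simp: q_def)
  have "\<exists>z\<in>span (f ` I). (norm (y - z))\<^sup>2 \<le> q ^ n * (norm y)\<^sup>2" for n
  proof (induction n)
    case 0
    then show ?case by (intro bexI[of _ 0]) (auto simp: span_zero)
  next
    case (Suc n)
    then obtain z where z: "z \<in> span (f ` I)" "(norm (y - z))\<^sup>2 \<le> q ^ n * (norm y)\<^sup>2" by blast
    obtain u where u: "u \<in> span (f ` I)"
      "(norm (y - z - u))\<^sup>2 \<le> (1 - a\<^sup>2 / b\<^sup>2) * (norm (y - z))\<^sup>2"
      using frame_step[OF ab] by blast
    note u(2)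
    also have "(1 - a\<^sup>2 / b\<^sup>2) * (norm (y - z))\<^sup>2 \<le> q * (norm (y - z))\<^sup>2"
      by (intro mult_right_mono) (auto simp: q_def)
    also have "\<dots> \<le> q * (q ^ n * (norm y)\<^sup>2)"
      using z q by (intro mult_left_mono) auto
    finally show ?case
      using z u by (intro bexI[of _ "z + u"]) (auto simp: span_add diff_diff_eq)
  qed
  moreover have "(\<lambda>n. q ^ n * (norm y)\<^sup>2) \<longlonglongrightarrow> 0"
    using q by (intro tendsto_mult_left_zero LIMSEQ_power_zero) auto
  then have "\<exists>n. q ^ n * (norm y)\<^sup>2 < \<delta>\<^sup>2"
    using assms(2) order_tendstoD(2)[of _ 0 sequentially "\<delta>\<^sup>2"]
    by (metis (no_types, lifting) eventually_sequentially order_refl zero_less_power)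
  ultimately obtain z where "z \<in> span (f ` I)" "(norm (y - z))\<^sup>2 < \<delta>\<^sup>2"
    by (meson order_le_less_trans)
  then show ?thesis using assms(2) by (meson less_imp_le power2_less_imp_less)
qed

section \<open>Counting removable elements against a Riesz bound\<close>

text \<open>Spans are described by sets of vectors, but \<open>f\<close> may repeat vectors;
  choosing one index for each vector turns the sum into one over indices.\<close>

lemma span_image_explicit:
  assumes "z \<in> span (f ` I)"
  obtains F c where "finite F" "F \<subseteq> I" "z = (\<Sum>k\<in>F. smul (c k) (f k))"
proof -
  obtain t r where t: "finite t" "t \<subseteq> f ` I" "z = (\<Sum>v\<in>t. smul (r v) v)"
    using assms unfolding span_explicit by blast
  obtain F where F: "F \<subseteq> I" "finite F" "t = f ` F" "inj_on f F"
    using t unfolding subset_image_inj by (metis finite_imageD)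
  have "z = (\<Sum>k\<in>F. smul (r (f k)) (f k))"
    using t F by (simp add: sum.reindex)
  from that[OF F(2,1) this] show ?thesis .
qed

text \<open>
  Approximate every \<open>h k\<close> with \<open>k \<in> K - J\<close> by finite sums over \<open>I - K\<close>.  If \<open>card K > card J\<close>, some
  nontrivial combination of these approximations has no coefficients in \<open>J - K\<close>, and so is a
  relation over \<open>I - J\<close> up to a small error, against the Riesz bound.
\<close>

lemma riesz_frame_card_le:
  assumes "riesz r (I - J) h" "r > 0" "is_frame ip (I - K) h"
    and "finite J" "finite K" "K \<subseteq> I"
  shows "card K \<le> card J"
proof (rule ccontr)
  assume "\<not> card K \<le> card J"
  define F where "F = K - J"
  define G where "G = J - K"
  have fin: "finite F" "finite G" using assms by (auto simp: F_def G_def)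
  have "card K = card F + card (J \<inter> K)" "card J = card G + card (J \<inter> K)"
    using assms card_Int_Diff[of K J] card_Int_Diff[of J K]
    by (auto simp: F_def G_def Int_commute)
  then have cFG: "card G < card F" using \<open>\<not> card K \<le> card J\<close> by linarith
  then have F0: "card F > 0" by linarith
  \<comment> \<open>Chosen so that \<open>card F\<close> errors, each at most
    \<open>N * \<delta>\<close>, add up to half of the Riesz bound \<open>r * N\<close>.\<close>
  define \<delta> where "\<delta> = r / (2 * card F)"
  have \<delta>: "\<delta> > 0" using F0 assms by (simp add: \<delta>_def)
  have "\<exists>L c. finite L \<and> L \<subseteq> I - K \<and> norm (h k - (\<Sum>i\<in>L. smul (c i) (h i))) < \<delta>" for k
    using frame_dense_span[OF assms(3) \<delta>, of "h k"] by (metis span_image_explicit)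
  then obtain L c where L: "\<And>k. finite (L k)" "\<And>k. L k \<subseteq> I - K"
    and d: "\<And>k. norm (h k - (\<Sum>i\<in>L k. smul (c k i) (h i))) < \<delta>"
    by metis
  define M where "M = (\<Union>k\<in>F. L k)"
  define c' where "c' k i = (if i \<in> L k then c k i else 0)" for k i
  have M: "finite M" "M \<subseteq> I - K" using fin L by (auto simp: M_def)
  have d': "norm (h k - (\<Sum>i\<in>M. smul (c' k i) (h i))) < \<delta>" if "k \<in> F" for k
  proof -
    have "(\<Sum>i\<in>M. smul (c' k i) (h i)) = (\<Sum>i\<in>L k. smul (c k i) (h i))"
      using M that by (intro sum.mono_neutral_cong_right) (auto simp: M_def c'_def)
    then show ?thesis using d by simp
  qed
  obtain l where l: "\<exists>k\<in>F. l k \<noteq> 0" "\<And>j. j \<in> G \<Longrightarrow> (\<Sum>k\<in>F. l k * c' k j) = 0"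
    using nontrivial_solution[OF fin(2,1) cFG, of c'] by blast
  define m where "m i = (\<Sum>k\<in>F. l k * c' k i)" for i
  define e where "e i = (if i \<in> F then l i else - m i)" for i
  have disj: "F \<inter> (M - J) = {}" using M by (auto simp: F_def)
  have "(\<Sum>k\<in>F. smul (l k) (\<Sum>i\<in>M. smul (c' k i) (h i))) = (\<Sum>i\<in>M. smul (m i) (h i))"
    unfolding m_def scale_sum_right scale_sum_left scale_scale by (rule sum.swap)
  \<comment> \<open>Since \<open>M\<close> avoids \<open>K\<close>, its indices in \<open>J\<close>
    lie in \<open>G\<close>, where \<open>m\<close> vanishes by the choice of
    \<open>l\<close>.\<close>
  also have "\<dots> = (\<Sum>i\<in>M - J. smul (m i) (h i))"
    using M l by (intro sum.mono_neutral_right) (auto simp: m_def G_def)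
  finally have "(\<Sum>k\<in>F. smul (l k) (h k - (\<Sum>i\<in>M. smul (c' k i) (h i)))) =
      (\<Sum>k\<in>F. smul (l k) (h k)) - (\<Sum>i\<in>M - J. smul (m i) (h i))"
    by (simp add: scale_right_diff_distrib sum_subtractf)
  also have "\<dots> = (\<Sum>k\<in>F. smul (e k) (h k)) + (\<Sum>i\<in>M - J. smul (e i) (h i))"
  proof -
    have "(\<Sum>i\<in>M - J. smul (e i) (h i)) = (\<Sum>i\<in>M - J. - smul (m i) (h i))"
      using disj by (intro sum.cong) (auto simp: e_def)
    then show ?thesis by (simp add: e_def sum_negf)
  qed
  also have "\<dots> = (\<Sum>k\<in>F \<union> (M - J). smul (e k) (h k))"
    using fin M disj by (intro sum.union_disjoint[symmetric]) auto
  finally have eq: "(\<Sum>k\<in>F. smul (l k) (h k - (\<Sum>i\<in>M. smul (c' k i) (h i)))) =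
    (\<Sum>k\<in>F \<union> (M - J). smul (e k) (h k))" .
  define N where "N = L2_set (\<lambda>k. norm (e k)) (F \<union> (M - J))"
  have le: "norm (l k) \<le> N" if "k \<in> F" for k
    using member_le_L2_set[of "F \<union> (M - J)" k "\<lambda>k. norm (e k)"] that fin M
    by (auto simp: N_def e_def)
  have N: "N > 0" using l(1) le by (metis order_less_le_trans zero_less_norm_iff)
  have "r * N \<le> norm (\<Sum>k\<in>F \<union> (M - J). smul (e k) (h k))"
    unfolding N_def using fin M assms(6)
    by (intro assms(1)[unfolded riesz_def, rule_format]) (auto simp: F_def)
  also have "\<dots> \<le> (\<Sum>k\<in>F. norm (l k) * norm (h k - (\<Sum>i\<in>M. smul (c' k i) (h i))))"
    unfolding eq[symmetric] by (rule order_trans[OF norm_sum]) simp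
  also have "\<dots> \<le> (\<Sum>k\<in>F. N * \<delta>)"
    using d' le \<delta> N by (intro sum_mono mult_mono) (auto intro: less_imp_le)
  also have "\<dots> = r * N / 2" using F0 by (simp add: \<delta>_def)
  finally show False using N assms(2) by simp
qed

section \<open>Exact frames satisfy a Riesz bound\<close>

text \<open>Removing \<open>k\<close> keeps the Bessel bound, so every positive lower bound must
  fail: some \<open>x\<close> has very small coefficients away from \<open>k\<close>. The lower
  bound of the whole family forces a large coefficient at \<open>k\<close>, and dividing by it
  normalises.\<close>

lemma almost_biorthogonal:
  assumes "is_frame ip I f" "k \<in> I" "\<not> is_frame ip (I - {k}) f" "\<delta> > 0"
  shows "\<exists>x. ip x (f k) = 1 \<and>
    (\<forall>F. finite F \<longrightarrow> F \<subseteq> I - {k} \<longrightarrow> L2_set (\<lambda>j. norm (ip x (f j))) F \<le> \<delta>)"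
proof -
  obtain a b where ab: "lower_bound a I f" "a > 0" "bessel b I f" "b > 0"
    using assms unfolding is_frame_iff by blast
  \<comment> \<open>The factor 1/2 makes the coefficient at \<open>k\<close> exceed
    \<open>a / 2 * norm x\<close>; the factor \<open>\<delta>/2\<close> brings the other
    coefficients below \<delta> after the division.\<close>
  define d where "d = a * min (1/2) (\<delta>/2)"
  have d: "d > 0" using ab assms by (simp add: d_def)
  have "bessel b (I - {k}) f" using ab unfolding bessel_def by blast
  then have "\<not> lower_bound d (I - {k}) f" using assms ab d unfolding is_frame_iff by blast
  then obtain x where x: "\<And>F. finite F \<Longrightarrow> F \<subseteq> I - {k} \<Longrightarrow>
      L2_set (\<lambda>j. norm (ip x (f j))) F < d * norm x"
    unfolding lower_bound_def by (meson not_le)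
  \<comment> \<open>The strict inequality on the empty set already excludes
    \<open>x = 0\<close>.\<close>
  have x0: "norm x > 0" using x[of "{}"] d by (auto simp: zero_less_mult_iff)
  obtain F where F: "finite F" "F \<subseteq> I" "a * norm x \<le> L2_set (\<lambda>j. norm (ip x (f j))) F"
    using ab unfolding lower_bound_def by blast
  have "L2_set (\<lambda>j. norm (ip x (f j))) F \<le> L2_set (\<lambda>j. norm (ip x (f j))) (insert k (F - {k}))"
    using F by (intro L2_set_subset) auto
  also have "\<dots> \<le> norm (ip x (f k)) + L2_set (\<lambda>j. norm (ip x (f j))) (F - {k})"
    using F by (subst L2_set_insert) (auto intro!: sqrt_sum_squares_le_sum simp: L2_set_nonneg)
  also have "L2_set (\<lambda>j. norm (ip x (f j))) (F - {k}) < d * norm x"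
    using F by (intro x) auto
  finally have "a * norm x < norm (ip x (f k)) + d * norm x" using F by simp
  moreover have "d * norm x \<le> a / 2 * norm x"
    using ab by (intro mult_right_mono) (auto simp: d_def)
  ultimately have big: "a / 2 * norm x < norm (ip x (f k))" by simp
  define y where "y = smul (inverse (ip x (f k))) x"
  have pos: "ip x (f k) \<noteq> 0" using big ab x0 by (auto simp: mult_less_0_iff)
  have "L2_set (\<lambda>j. norm (ip y (f j))) G \<le> \<delta>" if G: "finite G" "G \<subseteq> I - {k}" for G
  proof -
    have "L2_set (\<lambda>j. norm (ip y (f j))) G = inverse (norm (ip x (f k))) * L2_set (\<lambda>j. norm (ip x (f j))) G"
      by (simp add: y_def ip_smul_left norm_mult norm_inverse L2_set_right_distrib)
    also have "\<dots> \<le> inverse (norm (ip x (f k))) * (\<delta> * norm (ip x (f k)))"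
    proof (intro mult_left_mono)
      have "d * norm x \<le> \<delta> * (a / 2) * norm x"
        using ab by (intro mult_right_mono) (auto simp: d_def)
      also have "\<dots> \<le> \<delta> * norm (ip x (f k))"
        using big assms(4) by simp
      finally show "L2_set (\<lambda>j. norm (ip x (f j))) G \<le> \<delta> * norm (ip x (f k))"
        using x[OF G] by linarith
    qed simp
    also have "\<dots> = \<delta>" using pos by simp
    finally show ?thesis .
  qed
  moreover have "ip y (f k) = 1" using pos by (simp add: y_def ip_smul_left)
  ultimately show ?thesis by blast
qed


text \<open>The combination \<open>y\<close> of the \<open>f k\<close> is tested against
  \<open>z\<close>, the combination of almost biorthogonal vectors with the same coefficients. The
  pairing \<open>ip y z\<close> has norm at least \<open>N * N / 2\<close>, and the coefficients of
  \<open>z\<close> are those of \<open>y\<close> up to \<open>N / 2\<close> in l2, so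
  \<open>a * norm z \<le> 3/2 * N\<close>. Cauchy-Schwarz then gives the constant
  \<open>a / 3\<close>, which does not depend on \<open>F\<close> although the vectors do.\<close>

lemma riesz_if_exact_frame:
  assumes "is_frame ip I f" "\<And>k. k \<in> I \<Longrightarrow> \<not> is_frame ip (I - {k}) f"
  shows "\<exists>r>0. riesz r I f"
proof -
  obtain a where a: "lower_bound a I f" "a > 0"
    using assms unfolding is_frame_iff by blast
  have "a / 3 * L2_set (\<lambda>k. norm (c k)) F \<le> norm (\<Sum>k\<in>F. smul (c k) (f k))"
    if F: "finite F" "F \<subseteq> I" for c F
  proof (cases "F = {}")
    case False
    define N where "N = L2_set (\<lambda>k. norm (c k)) F"
    define y where "y = (\<Sum>k\<in>F. smul (c k) (f k))"
    \<comment> \<open>The \<open>card F\<close> error terms, each at most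
      \<open>N * \<delta>\<close>, then add up to at most \<open>N / 2\<close>.\<close>
    define \<delta> where "\<delta> = 1 / (2 * real (card F))"
    have cF: "card F > 0" using F False by (simp add: card_gt_0_iff)
    then have \<delta>: "\<delta> > 0" by (simp add: \<delta>_def)
    have "\<exists>x. ip x (f k) = 1 \<and>
      (\<forall>G. finite G \<longrightarrow> G \<subseteq> I - {k} \<longrightarrow> L2_set (\<lambda>j. norm (ip x (f j))) G \<le> \<delta>)" if "k \<in> F" for k
      using almost_biorthogonal[OF assms(1) _ assms(2) \<delta>] that F by blast
    then obtain x where x1: "\<And>k. k \<in> F \<Longrightarrow> ip (x k) (f k) = 1"
      and x2: "\<And>k G. k \<in> F \<Longrightarrow> finite G \<Longrightarrow> G \<subseteq> I - {k} \<Longrightarrow>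
        L2_set (\<lambda>j. norm (ip (x k) (f j))) G \<le> \<delta>"
      by metis
    define z where "z = (\<Sum>k\<in>F. smul (c k) (x k))"
    define c' where "c' j = (if j \<in> F then c j else 0)" for j
    \<comment> \<open>The matrix of the \<open>x k\<close> against the \<open>f j\<close> without
      its diagonal, which is exactly 1 on \<open>F\<close> and causes no error.\<close>
    define v where "v k j = (if j = k then 0 else norm (ip (x k) (f j)))" for k j
    define u where "u j = (\<Sum>k\<in>F. norm (c k) * v k j)" for j
    have u: "norm (ip z (f j) - c' j) \<le> u j" for j
    proof -
      have "ip z (f j) - c' j = (\<Sum>k\<in>F. c k * ip (x k) (f j) - (if j = k then c k else 0))"
        unfolding sum_subtractf c'_def
        using F by (simp add: z_def ip_sum_left ip_smul_left)
      also have "norm \<dots> \<le> (\<Sum>k\<in>F. norm (c k) * v k j)"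
        by (rule sum_norm_le) (auto simp: v_def x1 norm_mult)
      finally show ?thesis by (simp add: u_def)
    qed
    have cN: "norm (c k) \<le> N" if "k \<in> F" for k
      using member_le_L2_set[OF F(1) that, of "\<lambda>k. norm (c k)"] by (simp add: N_def)
    have N0: "N \<ge> 0" by (simp add: N_def L2_set_nonneg)
    have uN: "L2_set u G \<le> N / 2" if G: "finite G" "G \<subseteq> I" for G
    proof -
      have "L2_set (v k) G \<le> \<delta>" if k: "k \<in> F" for k
      proof -
        have "L2_set (v k) G = L2_set (v k) (G - {k})"
          unfolding L2_set_def using G
          by (intro arg_cong[of _ _ sqrt] sum.mono_neutral_right) (auto simp: v_def)
        also have "\<dots> = L2_set (\<lambda>j. norm (ip (x k) (f j))) (G - {k})"
          by (rule L2_set_cong) (auto simp: v_def)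
        also have "\<dots> \<le> \<delta>" using G k by (intro x2) auto
        finally show ?thesis .
      qed
      then have "(\<Sum>k\<in>F. norm (c k) * L2_set (v k) G) \<le> (\<Sum>k\<in>F. N * \<delta>)"
        using cN N0 by (intro sum_mono mult_mono) (auto simp: L2_set_nonneg)
      also have "\<dots> = N / 2" using cF by (simp add: \<delta>_def)
      finally show ?thesis
        using L2_set_sum_le[of "\<lambda>k j. norm (c k) * v k j" F G]
        unfolding u_def by (simp add: L2_set_right_distrib[symmetric])
    qed
    have zN: "a * norm z \<le> 3/2 * N"
    proof -
      obtain G where G: "finite G" "G \<subseteq> I" "a * norm z \<le> L2_set (\<lambda>j. norm (ip z (f j))) G"
        using a unfolding lower_bound_def by blast
      note G(3)
      also have "L2_set (\<lambda>j. norm (ip z (f j))) G \<le> L2_set (\<lambda>j. norm (c' j) + u j) G"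
        using u by (intro L2_set_mono) (auto simp: norm_triangle_sub intro: order_trans[OF norm_triangle_sub add_left_mono])
      also have "\<dots> \<le> L2_set (\<lambda>j. norm (c' j)) G + L2_set u G" by (rule L2_set_triangle_ineq)
      also have "L2_set (\<lambda>j. norm (c' j)) G = L2_set (\<lambda>j. norm (c' j)) (G \<inter> F)"
        unfolding L2_set_def using G
        by (intro arg_cong[of _ _ sqrt] sum.mono_neutral_right) (auto simp: c'_def)
      also have "\<dots> = L2_set (\<lambda>j. norm (c j)) (G \<inter> F)"
        by (rule L2_set_cong) (auto simp: c'_def)
      also have "\<dots> \<le> N" unfolding N_def using F by (intro L2_set_subset) auto
      finally show ?thesis using uN[OF G(1,2)] by simp
    qed
    have "ip y z = (\<Sum>k\<in>F. c k * conj (ip z (f k)))"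
      unfolding y_def ip_sum_left ip_smul_left by (intro sum.cong refl) (metis ip_conj)
    also have "\<dots> = (\<Sum>k\<in>F. c k * conj (c k)) + (\<Sum>k\<in>F. c k * conj (ip z (f k) - c k))"
      by (simp add: conj_diff algebra_simps sum_subtractf)
    also have "(\<Sum>k\<in>F. c k * conj (c k)) = of_real (N\<^sup>2)"
      by (simp add: mult_conj' N_def L2_set_def sum_nonneg del: of_real_power)
    finally have yz: "of_real (N\<^sup>2) = ip y z - (\<Sum>k\<in>F. c k * conj (ip z (f k) - c k))" by simp
    have "norm (\<Sum>k\<in>F. c k * conj (ip z (f k) - c k)) \<le> (\<Sum>k\<in>F. \<bar>norm (c k)\<bar> * \<bar>u k\<bar>)"
    proof (rule sum_norm_le)
      fix k assume "k \<in> F"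
      then have "norm (ip z (f k) - c k) \<le> \<bar>u k\<bar>" using u[of k] by (simp add: c'_def)
      then show "norm (c k * conj (ip z (f k) - c k)) \<le> \<bar>norm (c k)\<bar> * \<bar>u k\<bar>"
        by (simp add: norm_mult mult_left_mono)
    qed
    also have "\<dots> \<le> N * L2_set u F" unfolding N_def by (rule L2_set_mult_ineq)
    also have "\<dots> \<le> N * (N / 2)" using uN[OF F] N0 by (intro mult_left_mono) auto
    finally have "norm (of_real (N\<^sup>2) :: 'k) \<le> norm (ip y z) + N * (N / 2)"
      unfolding yz using norm_triangle_ineq4 order_trans add_left_mono by blast
    moreover have "norm (of_real (N\<^sup>2) :: 'k) = N * N"
      by (simp add: power2_eq_square norm_mult)
    ultimately have "N * N / 2 \<le> norm (ip y z)" by simp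
    also have "\<dots> \<le> norm y * norm z" by (rule cauchy_schwarz)
    finally have "a * (N * N / 2) \<le> a * (norm y * norm z)" using a by simp
    also have "\<dots> = norm y * (a * norm z)" by simp
    also have "\<dots> \<le> norm y * (3/2 * N)" using zN by (intro mult_left_mono) auto
    finally have "(a / 3 * N) * N \<le> norm y * N" by simp
    then have "a / 3 * N \<le> norm y" using N0 by (cases "N = 0") auto
    then show ?thesis by (simp add: N_def y_def)
  qed simp
  then show ?thesis unfolding riesz_def using a by (intro exI[of _ "a/3"]) auto
qed

section \<open>Constancy of the excess along a segment of frames\<close>

text \<open>The supremum reaches a finite \<open>n > 0\<close> only if a member does, since
  otherwise all members are at most \<open>n - 1\<close>. For \<open>n = 0\<close> the empty set is
  removable because the family is a frame.\<close>

lemma excess_ge_iff: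
  assumes "is_frame ip I f"
  shows "enat n \<le> excess ip I f \<longleftrightarrow>
    (\<exists>J. finite J \<and> J \<subseteq> I \<and> is_frame ip (I - J) f \<and> n \<le> card J)"
proof
  assume le: "enat n \<le> excess ip I f"
  show "\<exists>J. finite J \<and> J \<subseteq> I \<and> is_frame ip (I - J) f \<and> n \<le> card J"
  proof (cases "n = 0")
    case True
    then show ?thesis using assms by (intro exI[of _ "{}"]) auto
  next
    case False
    show ?thesis
    proof (rule ccontr)
      assume "\<not> ?thesis"
      then have "excess ip I f \<le> enat (n - 1)"
        unfolding excess_def by (intro Sup_least) (clarsimp, fastforce)
      with le have "enat n \<le> enat (n - 1)" by (rule order_trans)
      then show False using False by simp
    qed
  qed
next
  assume "\<exists>J. finite J \<and> J \<subseteq> I \<and> is_frame ip (I - J) f \<and> n \<le> card J"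
  then obtain J where J: "finite J" "J \<subseteq> I" "is_frame ip (I - J) f" "n \<le> card J" by blast
  have "enat n \<le> enat (card J)" using J by simp
  also have "\<dots> \<le> excess ip I f" unfolding excess_def using J by (intro Sup_upper) auto
  finally show "enat n \<le> excess ip I f" .
qed

text \<open>The radius comes from the bound left after removing a set that depends on
  \<open>n\<close>. Fixing \<open>n\<close> therefore allows infinite excess, where no common radius
  is claimed.\<close>

lemma excess_locally_constant:
  assumes "is_frame ip I f"
  shows "\<exists>\<delta>>0. \<forall>g. is_frame ip I g \<longrightarrow> close \<delta> I f g \<longrightarrow>
    (enat n \<le> excess ip I f \<longleftrightarrow> enat n \<le> excess ip I g)"
proof (cases "enat n \<le> excess ip I f")
  case True
  then obtain J where J: "finite J" "J \<subseteq> I" "is_frame ip (I - J) f" "n \<le> card J"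
    using excess_ge_iff[OF assms] by blast
  obtain a where a: "lower_bound a (I - J) f" "a > 0" using J unfolding is_frame_iff by blast
  have "enat n \<le> excess ip I g" if "is_frame ip I g" "close (a/2) I f g" for g
    using is_frame_perturb[OF J(3) a(1) close_subset[OF that(2)]] a J excess_ge_iff[OF that(1)]
    by auto
  then show ?thesis using True a by (intro exI[of _ "a/2"]) auto
next
  case False
  define P where "P J \<longleftrightarrow> finite J \<and> J \<subseteq> I \<and> is_frame ip (I - J) f" for J
  have bd: "\<forall>J. P J \<longrightarrow> card J < n"
    using False excess_ge_iff[OF assms] by (auto simp: P_def not_le)
  have "P {}" using assms by (simp add: P_def)
  \<comment> \<open>Removable sets have fewer than \<open>n\<close> elements, so a largest one
    exists. By maximality what remains is exact, hence has a Riesz bound, half of which survives for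
    \<open>g\<close>.\<close>
  then obtain J where J: "P J" "\<And>K. P K \<Longrightarrow> card K \<le> card J"
    using ex_has_greatest_nat[of P "{}" card n] bd by (auto intro: less_imp_le)
  have "\<not> is_frame ip (I - J - {k}) f" if "k \<in> I - J" for k
  proof
    assume "is_frame ip (I - J - {k}) f"
    moreover have "I - insert k J = I - J - {k}" by blast
    ultimately have "P (insert k J)" using that J(1) by (simp add: P_def)
    from J(2)[OF this] show False using that J(1) by (simp add: P_def)
  qed
  then obtain r where r: "r > 0" "riesz r (I - J) f"
    using riesz_if_exact_frame[of "I - J" f] J(1) by (auto simp: P_def)
  have "\<not> enat n \<le> excess ip I g" if g: "is_frame ip I g" "close (r/2) I f g" for g
  proof
    assume "enat n \<le> excess ip I g"
    then obtain K where K: "finite K" "K \<subseteq> I" "is_frame ip (I - K) g" "n \<le> card K"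
      using excess_ge_iff[OF g(1)] by blast
    have "riesz (r - r/2) (I - J) g" using riesz_perturb[OF r(2) close_subset[OF g(2)]] by auto
    then have "card K \<le> card J" 
      using riesz_frame_card_le[OF _ _ K(3) _ K(1,2)] r J(1) by (auto simp: P_def)
    moreover have "card J < n" using J(1) bd by blast
    ultimately show False using K(4) by linarith
  qed
  then show ?thesis using False r by (intro exI[of _ "r/2"]) auto
qed

text \<open>The condition \<open>d < a\<close> keeps the whole segment inside the frames;
  connectedness of \<open>{0..1}\<close> then carries local constancy from one end to the other,
  separately for each \<open>n\<close>.\<close>

lemma excess_perturb:
  assumes f: "is_frame ip I f" "lower_bound a I f" and g: "close d I f g" "d < a"
  shows "excess ip I g = excess ip I f"
proof -
  define h where "h t k = f k + t *\<^sub>R (g k - f k)" for t :: real and k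
  have cl: "close (\<bar>s - t\<bar> * d) I (h s) (h t)" for s t
    unfolding close_def
  proof (intro allI impI)
    fix F assume F: "finite F" "F \<subseteq> I"
    have "norm (h s k - h t k) = \<bar>s - t\<bar> * norm (f k - g k)" for k
    proof -
      have "h s k - h t k = (s - t) *\<^sub>R (g k - f k)" by (simp add: h_def algebra_simps)
      then show ?thesis by (simp add: norm_minus_commute)
    qed
    then have "L2_set (\<lambda>k. norm (h s k - h t k)) F = \<bar>s - t\<bar> * L2_set (\<lambda>k. norm (f k - g k)) F"
      by (simp add: L2_set_right_distrib)
    also have "\<dots> \<le> \<bar>s - t\<bar> * d" using g(1) F unfolding close_def by (intro mult_left_mono) auto
    finally show "L2_set (\<lambda>k. norm (h s k - h t k)) F \<le> \<bar>s - t\<bar> * d" .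
  qed
  have d: "d \<ge> 0" by (rule close_nonneg[OF g(1)])
  have h0: "h 0 = f" and h1: "h 1 = g" by (auto simp: h_def)
  have fr: "is_frame ip I (h t)" if "t \<in> {0..1}" for t
  proof (rule is_frame_perturb[OF f])
    show "close (t * d) I f (h t)" using cl[of 0 t] that by (simp add: h0)
    show "t * d < a" using mult_right_mono[of t 1 d] that g d by auto
  qed
  have "enat n \<le> excess ip I (h 0) \<longleftrightarrow> enat n \<le> excess ip I (h 1)" for n
  proof (rule connected_equivalence_relation[of "{0..1::real}" 0 1
        "\<lambda>s t. enat n \<le> excess ip I (h s) \<longleftrightarrow> enat n \<le> excess ip I (h t)"])
    fix t :: real assume t: "t \<in> {0..1}"
    obtain \<delta> where \<delta>: "\<delta> > 0" "\<And>g. is_frame ip I g \<Longrightarrow> close \<delta> I (h t) g \<Longrightarrow>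
        (enat n \<le> excess ip I (h t) \<longleftrightarrow> enat n \<le> excess ip I g)"
      using excess_locally_constant[OF fr[OF t], of n] by blast
    \<comment> \<open>The denominator \<open>d + 1\<close> covers the case
      \<open>d = 0\<close>.\<close>
    define \<eta> where "\<eta> = \<delta> / (d + 1)"
    have \<eta>: "\<eta> > 0" using \<delta> d by (simp add: \<eta>_def)
    have "close \<delta> I (h t) (h s)" if "dist t s < \<eta>" for s
    proof -
      have "\<bar>t - s\<bar> * d \<le> \<eta> * (d + 1)"
        using that d \<eta> by (intro mult_mono) (auto simp: dist_real_def)
      also have "\<dots> = \<delta>" using d by (simp add: \<eta>_def)
      finally show ?thesis using cl[of t s] unfolding close_def by (meson order_trans)
    qed
    then show "\<exists>T. openin (top_of_set {0..1}) T \<and> t \<in> T \<and>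
        (\<forall>s\<in>T. (enat n \<le> excess ip I (h t)) = (enat n \<le> excess ip I (h s)))"
      using \<delta>(2) fr t \<eta>
      by (intro exI[of _ "{0..1} \<inter> ball t \<eta>"]) (auto intro!: openin_open_Int)
  qed auto
  then have "\<forall>n. enat n \<le> excess ip I f \<longleftrightarrow> enat n \<le> excess ip I g" by (simp add: h0 h1)
  then show ?thesis
    by (intro enat_eqI) simp
qed

section \<open>Approximation by elements of the orbit\<close>

lemma eps_approximation_if_close:
  assumes "close (sqrt \<epsilon>) I f g" "\<epsilon> > 0"
  shows "eps_approximation smul \<epsilon> I g f"
  unfolding eps_approximation_def
proof (intro allI impI, elim conjE)
  fix F c assume F: "finite F" "F \<subseteq> I"
  from power_mono[OF close_synthesis[OF assms(1) F, of c], of 2]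
  show "(norm (\<Sum>k\<in>F. smul (c k) (f k - g k)))\<^sup>2 \<le> \<epsilon> * (\<Sum>k\<in>F. (norm (c k))\<^sup>2)"
    using assms by (simp add: power_mult_distrib L2_set_def sum_nonneg)
qed

lemma close_if_geometric:
  fixes f g :: "nat \<Rightarrow> 'a"
  assumes "\<epsilon> > 0" "\<forall>k\<ge>1. (norm (f k - g k))\<^sup>2 \<le> \<epsilon> / 2 ^ k"
  shows "close (sqrt \<epsilon>) {1..} f g"
  unfolding close_def L2_set_def
proof (intro allI impI real_sqrt_le_mono)
  fix F :: "nat set" assume F: "finite F" "F \<subseteq> {1..}"
  have s: "(\<lambda>k. \<epsilon> * (1/2) ^ Suc k) sums \<epsilon>"
    using sums_mult[OF power_half_series, of \<epsilon>] by simp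
  \<comment> \<open>The family starts at 1 and the series at 0, hence the shift; truncated
    subtraction is injective because \<open>F\<close> does not contain 0.\<close>
  have inj: "inj_on (\<lambda>k. k - 1) F"
    using F by (intro inj_on_diff_nat) auto
  have "(\<Sum>k\<in>F. (norm (f k - g k))\<^sup>2) \<le> (\<Sum>k\<in>F. \<epsilon> * (1/2) ^ k)"
    using assms F by (intro sum_mono) (auto simp: power_divide)
  also have "\<dots> = (\<Sum>k\<in>(\<lambda>k. k - 1) ` F. \<epsilon> * (1/2) ^ Suc k)"
    using F by (subst sum.reindex[OF inj])
      (auto simp: subset_iff Suc_le_eq intro!: sum.cong simp flip: power_Suc)
  also have "\<dots> \<le> \<epsilon>"
    using sum_le_suminf[of "\<lambda>k. \<epsilon> * (1/2) ^ Suc k" "(\<lambda>k. k - 1) ` F"] s F assms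
    by (simp add: sums_iff)
  finally show "(\<Sum>k\<in>F. (norm (f k - g k))\<^sup>2) \<le> \<epsilon>" .
qed

end

lemma hypercyclic_approx:
  assumes "hypercyclic_vector T \<phi>" "\<delta> > 0"
  shows "\<exists>n. (norm (x - (T ^^ n) \<phi>))\<^sup>2 \<le> \<delta>"
proof -
  have "x \<in> closure (range (\<lambda>n. (T ^^ n) \<phi>))"
    using assms by (simp add: hypercyclic_vector_def)
  moreover have "sqrt \<delta> > 0" using assms by simp
  ultimately obtain n where "dist ((T ^^ n) \<phi>) x < sqrt \<delta>"
    unfolding closure_approachable by blast
  then have "norm (x - (T ^^ n) \<phi>) \<le> sqrt \<delta>"
    by (simp add: dist_norm norm_minus_commute)
  from power_mono[OF this, of 2] show ?thesis using assms by auto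
qed

text \<open>\<open>\<epsilon>\<^sub>0\<close> precedes \<open>T\<close> and \<open>\<phi>\<close> so
  that it depends on the frame alone, and the consequences are drawn for every admissible \<alpha>,
  not just for one that was constructed.\<close>

theorem mainTheorem4:
  fixes smul :: "'k::hilbert_scalar \<Rightarrow> 'a::banach \<Rightarrow> 'a"
    and ip :: "'a \<Rightarrow> 'a \<Rightarrow> 'k"
    and f :: "nat \<Rightarrow> 'a"
  assumes "hilbert_space smul ip"
    and "infinite_dimensional smul"
    and "separable_space (euclidean :: 'a topology)"
    and "is_frame ip {1..} f"
  shows "\<exists>\<epsilon>\<^sub>0>0. \<forall>T \<phi>. bounded_operator smul T \<and> hypercyclic_vector T \<phi> \<longrightarrow>
    (\<forall>\<epsilon>>0. \<exists>\<alpha>::nat \<Rightarrow> nat. \<forall>k\<ge>1. (norm (f k - (T ^^ \<alpha> k) \<phi>))\<^sup>2 \<le> \<epsilon> / 2 ^ k) \<and>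
    (\<forall>\<epsilon>. 0 < \<epsilon> \<and> \<epsilon> < \<epsilon>\<^sub>0 \<longrightarrow>
      (\<forall>\<alpha>::nat \<Rightarrow> nat. (\<forall>k\<ge>1. (norm (f k - (T ^^ \<alpha> k) \<phi>))\<^sup>2 \<le> \<epsilon> / 2 ^ k) \<longrightarrow>
        is_frame ip {1..} (\<lambda>k. (T ^^ \<alpha> k) \<phi>) \<and>
        excess ip {1..} (\<lambda>k. (T ^^ \<alpha> k) \<phi>) = excess ip {1..} f \<and>
        eps_approximation smul \<epsilon> {1..} (\<lambda>k. (T ^^ \<alpha> k) \<phi>) f))"
proof -
  interpret hilbert_space smul ip by fact
  obtain a where a: "a > 0" "lower_bound a {1..} f"
    using assms(4) unfolding is_frame_iff by blast
  \<comment> \<open>The threshold is the square of the lower bound: the orbit elements have l2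
    distance at most \<open>sqrt \<epsilon>\<close> from the frame, and the perturbation results
    need \<open>sqrt \<epsilon> < a\<close>.\<close>
  show ?thesis
  proof (intro exI[of _ "a\<^sup>2"] conjI allI impI; (elim conjE)?)
    show "a\<^sup>2 > 0" using a by simp
  next
    fix T :: "'a \<Rightarrow> 'a" and \<phi> and \<epsilon> :: real
    assume "hypercyclic_vector T \<phi>" "\<epsilon> > 0"
    then have "\<forall>k. \<exists>n. (norm (f k - (T ^^ n) \<phi>))\<^sup>2 \<le> \<epsilon> / 2 ^ k"
      by (intro allI hypercyclic_approx) auto
    then show "\<exists>\<alpha>::nat \<Rightarrow> nat. \<forall>k\<ge>1. (norm (f k - (T ^^ \<alpha> k) \<phi>))\<^sup>2 \<le> \<epsilon> / 2 ^ k"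
      by metis
  next
    fix T :: "'a \<Rightarrow> 'a" and \<phi> \<epsilon> and \<alpha> :: "nat \<Rightarrow> nat"
    assume \<epsilon>: "0 < \<epsilon>" "\<epsilon> < a\<^sup>2" "\<forall>k\<ge>1. (norm (f k - (T ^^ \<alpha> k) \<phi>))\<^sup>2 \<le> \<epsilon> / 2 ^ k"
    have cl: "close (sqrt \<epsilon>) {1..} f (\<lambda>k. (T ^^ \<alpha> k) \<phi>)"
      by (rule close_if_geometric[OF \<epsilon>(1,3)])
    have lt: "sqrt \<epsilon> < a" using \<epsilon> a by (simp add: real_less_lsqrt)
    show "is_frame ip {1..} (\<lambda>k. (T ^^ \<alpha> k) \<phi>)"
      by (rule is_frame_perturb[OF assms(4) a(2) cl lt])
    show "excess ip {1..} (\<lambda>k. (T ^^ \<alpha> k) \<phi>) = excess ip {1..} f"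
      by (rule excess_perturb[OF assms(4) a(2) cl lt])
    show "eps_approximation smul \<epsilon> {1..} (\<lambda>k. (T ^^ \<alpha> k) \<phi>) f"
      by (rule eps_approximation_if_close[OF cl \<epsilon>(1)])
  qed
qed

end
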